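(* For every integer $d\ge 3$ and all $\lambda,R>0$, almost surely there are no $2$-dimensional planes in $\mathbb{H}^d$ that are contained in $\mathcal{B}$. Similarly, almost surely there are no $2$-dimensional planes in $\mathbb{H}^d$ that are contained in $\mathcal{W}$.
   Context: $\mathbb{H}^d$ is $d$-dimensional hyperbolic space. $X$ is a Poisson point process of intensity $\lambda$ (with respect to hyperbolic volume) in $\mathbb{H}^d$, $B(x,R)$ is the open ball of radius $R$ about $x$, $\mathcal{B}:=\bigcup_{x\in X}B(x,R)$, and $\mathcal{W}$ is the closure of $\mathbb{H}^d\setminus\mathcal{B}$. A $2$-dimensional plane in $\mathbb{H}^d$ is a (complete) totally geodesic copy of $\mathbb{H}^2$ in $\mathbb{H}^d$. *)

theory Defs
  imports "HOL-Probability.Probability"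
begin

section \<open>Hyperbolic space\<close>

text \<open>
  The hyperboloid model (curvature \<open>-1\<close>). The dimension is \<open>CARD('n)\<close>, so that hyperbolic
  \<open>d\<close>-space is \<open>'n hyp\<close> with \<open>CARD('n) = d\<close>, and the hyperbolic plane is \<open>2 hyp\<close>.
\<close>

definition lorentz :: "'a::real_inner \<times> real \<Rightarrow> 'a \<times> real \<Rightarrow> real"
  where "lorentz p q = snd p * snd q - fst p \<bullet> fst q"

typedef ('n::finite) hyp = "{p :: (real^'n) \<times> real. snd p > 0 \<and> lorentz p p = 1}"
  morphisms hyp_coords Abs_hyp
  by (rule exI[of _ "(0, 1)"]) (simp add: lorentz_def)

lemma lorentz_commute: "lorentz p q = lorentz q p"
  by (simp add: lorentz_def inner_commute mult.commute)

lemma hyp_coords_pos: "snd (hyp_coords p) > 0"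
  and hyp_coords_self: "lorentz (hyp_coords p) (hyp_coords p) = 1"
  using hyp_coords[of p] by auto

lemma hyp_coords_self': "(snd (hyp_coords p))\<^sup>2 = 1 + fst (hyp_coords p) \<bullet> fst (hyp_coords p)"
  using hyp_coords_self[of p] by (simp add: lorentz_def power2_eq_square)

lemma snd_hyp_coords: "snd (hyp_coords p) = sqrt (1 + fst (hyp_coords p) \<bullet> fst (hyp_coords p))"
  using hyp_coords_self'[of p] hyp_coords_pos[of p] by (metis less_imp_le real_sqrt_unique)

lemma snd_hyp_coords_gt: "snd (hyp_coords p) > norm (fst (hyp_coords p))"
  unfolding snd_hyp_coords by (rule real_less_rsqrt) (simp add: dot_square_norm)

lemma lorentz_ge_1: "lorentz (hyp_coords p) (hyp_coords q) \<ge> 1"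
proof -
  obtain x s y t where [simp]: "hyp_coords p = (x, s)" "hyp_coords q = (y, t)"
    by (metis surj_pair)
  have s: "s > 0" "s\<^sup>2 = 1 + (norm x)\<^sup>2" and t: "t > 0" "t\<^sup>2 = 1 + (norm y)\<^sup>2"
    using hyp_coords_pos[of p] hyp_coords_pos[of q] hyp_coords_self'[of p] hyp_coords_self'[of q]
    by (simp_all add: dot_square_norm)
  have "(s * t)\<^sup>2 = (1 + norm x * norm y)\<^sup>2 + (norm x - norm y)\<^sup>2"
    unfolding power_mult_distrib s t by (simp add: algebra_simps power2_eq_square)
  then have "(1 + norm x * norm y)\<^sup>2 \<le> (s * t)\<^sup>2"
    using zero_le_power2[of "norm x - norm y"] by linarith
  moreover have "0 \<le> s * t"
    using s(1) t(1) by simp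
  ultimately have "1 + norm x * norm y \<le> s * t"
    by (rule power2_le_imp_le)
  moreover have "x \<bullet> y \<le> norm x * norm y"
    by (rule norm_cauchy_schwarz)
  ultimately show ?thesis
    by (simp add: lorentz_def)
qed

lemma lorentz_eq_1_iff: "lorentz (hyp_coords p) (hyp_coords q) = 1 \<longleftrightarrow> p = q"
proof
  assume eq: "lorentz (hyp_coords p) (hyp_coords q) = 1"
  obtain x s y t where pq [simp]: "hyp_coords p = (x, s)" "hyp_coords q = (y, t)"
    by (metis surj_pair)
  have s: "s > norm x" "s\<^sup>2 = 1 + x \<bullet> x" and t: "t > norm y" "t\<^sup>2 = 1 + y \<bullet> y"
    using snd_hyp_coords_gt[of p] snd_hyp_coords_gt[of q] hyp_coords_self'[of p] hyp_coords_self'[of q]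
    by simp_all
  have "(norm (x - y))\<^sup>2 = (s - t)\<^sup>2"
    using eq s t unfolding power2_norm_eq_inner
    by (simp add: lorentz_def power2_eq_square inner_diff_left inner_diff_right inner_commute algebra_simps)
  then have dist: "norm (x - y) = \<bar>s - t\<bar>"
    by (intro power2_eq_imp_eq[of "norm (x - y)" "\<bar>s - t\<bar>"]) simp_all
  have "s + t > 0"
    using s(1) t(1) norm_ge_zero[of x] norm_ge_zero[of y] by linarith
  then have "\<bar>s - t\<bar> * (s + t) = \<bar>s\<^sup>2 - t\<^sup>2\<bar>"
    by (simp add: power2_eq_square square_diff_square_factored abs_mult abs_of_pos)
  also have "\<dots> = \<bar>norm x - norm y\<bar> * (norm x + norm y)"
    unfolding s(2) t(2) dot_square_norm
    by (simp add: power2_eq_square square_diff_square_factored abs_mult)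
  also have "\<dots> \<le> norm (x - y) * (norm x + norm y)"
    by (intro mult_right_mono norm_triangle_ineq3) auto
  finally have "\<bar>s - t\<bar> * ((s + t) - (norm x + norm y)) \<le> 0"
    unfolding dist by (simp add: algebra_simps)
  then have "s = t"
    using s(1) t(1) by (simp add: mult_le_0_iff)
  with dist have "hyp_coords p = hyp_coords q" by simp
  then show "p = q" by (simp only: hyp_coords_inject)
qed (simp add: hyp_coords_self)

lemma lorentz_le_cosh_add:
  assumes "a = lorentz (hyp_coords p) (hyp_coords q)" "b = lorentz (hyp_coords q) (hyp_coords r)"
  shows "lorentz (hyp_coords p) (hyp_coords r) \<le> a * b + sqrt (a\<^sup>2 - 1) * sqrt (b\<^sup>2 - 1)"
proof -
  obtain x s y t z w where [simp]:
    "hyp_coords p = (x, s)" "hyp_coords q = (y, t)" "hyp_coords r = (z, w)"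
    by (metis surj_pair)
  have s: "x \<bullet> x = s\<^sup>2 - 1" and t: "t > 0" "y \<bullet> y = t\<^sup>2 - 1" and w: "z \<bullet> z = w\<^sup>2 - 1"
    using hyp_coords_pos[of q] hyp_coords_self'[of p] hyp_coords_self'[of q] hyp_coords_self'[of r]
    by simp_all
  have xy: "x \<bullet> y = s * t - a" and yz: "y \<bullet> z = t * w - b"
    using assms by (simp_all add: lorentz_def)
  define u where "u = x - a *\<^sub>R y"
  define v where "v = z - b *\<^sub>R y"
  define c where "c = 1 / (t * (t + 1))"
  define T where "T f = f - (c * (f \<bullet> y)) *\<^sub>R y" for f
  have uy: "u \<bullet> y = t * (s - a * t)" and vy: "v \<bullet> y = t * (w - b * t)"
    unfolding u_def v_def inner_diff_left inner_scaleR_left xy t(2) inner_commute[of z y] yz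
    by (simp_all add: algebra_simps power2_eq_square)
  have c: "(2 * c - c\<^sup>2 * (t\<^sup>2 - 1)) * t\<^sup>2 = 1"
  proof -
    have "t + 1 \<noteq> 0" using t(1) by simp
    have ct: "c * t * (t + 1) = 1" using t(1) by (simp add: c_def)
    have "(2 * c - c\<^sup>2 * (t\<^sup>2 - 1)) * t\<^sup>2
        = 2 * t * (c * t) - (c * t * (t + 1)) * (c * t) * (t - 1)"
      by (simp add: algebra_simps power2_eq_square)
    also have "\<dots> = c * t * (t + 1)"
      by (subst ct) (simp add: algebra_simps)
    finally show ?thesis using ct by simp
  qed
  have TT: "T f \<bullet> T g = f \<bullet> g - (2 * c - c\<^sup>2 * (t\<^sup>2 - 1)) * (f \<bullet> y) * (g \<bullet> y)" for f g
  proof -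
    have *: "T f \<bullet> T g = f \<bullet> g - c * (g \<bullet> y) * (f \<bullet> y)
        - c * (f \<bullet> y) * (g \<bullet> y - c * (g \<bullet> y) * (y \<bullet> y))"
      by (simp add: T_def inner_diff_left inner_diff_right inner_commute[of y g] right_diff_distrib)
    show ?thesis
      unfolding * t(2) by algebra
  qed
  have TT': "T f \<bullet> T g = f \<bullet> g - \<alpha> * \<beta>" if "f \<bullet> y = t * \<alpha>" "g \<bullet> y = t * \<beta>" for f g \<alpha> \<beta>
  proof -
    have "T f \<bullet> T g = f \<bullet> g - ((2 * c - c\<^sup>2 * (t\<^sup>2 - 1)) * t\<^sup>2) * (\<alpha> * \<beta>)"
      unfolding TT that by (simp add: algebra_simps power2_eq_square)
    then show ?thesis unfolding c by simp
  qed
  have uu: "T u \<bullet> T u = a\<^sup>2 - 1"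
    unfolding TT'[OF uy uy]
    unfolding u_def inner_diff_left inner_diff_right inner_scaleR_left inner_scaleR_right
      inner_commute[of y x] s xy t(2)
    by (simp add: algebra_simps power2_eq_square)
  have vv: "T v \<bullet> T v = b\<^sup>2 - 1"
    unfolding TT'[OF vy vy]
    unfolding v_def inner_diff_left inner_diff_right inner_scaleR_left inner_scaleR_right
      inner_commute[of z y] w yz t(2)
    by (simp add: algebra_simps power2_eq_square)
  have uv: "T u \<bullet> T v = a * b - lorentz (x, s) (z, w)"
    unfolding TT'[OF uy vy]
    unfolding u_def v_def lorentz_def inner_diff_left inner_diff_right inner_scaleR_left inner_scaleR_right
      xy yz t(2)
    by (simp add: algebra_simps power2_eq_square)
  have "- (T u \<bullet> T v) \<le> norm (T u) * norm (T v)"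
    using Cauchy_Schwarz_ineq2[of "T u" "T v"] by linarith
  then show ?thesis
    unfolding uv norm_eq_sqrt_inner uu vv by simp
qed

instantiation hyp :: (finite) metric_space
begin

definition dist_hyp :: "'a hyp \<Rightarrow> 'a hyp \<Rightarrow> real"
  where "dist_hyp p q = arcosh (lorentz (hyp_coords p) (hyp_coords q))"

definition uniformity_hyp :: "('a hyp \<times> 'a hyp) filter"
  where "uniformity_hyp = (INF e\<in>{0<..}. principal {(p, q). dist p q < e})"

definition open_hyp :: "'a hyp set \<Rightarrow> bool"
  where "open_hyp U \<longleftrightarrow> (\<forall>p\<in>U. eventually (\<lambda>(p', q). p' = p \<longrightarrow> q \<in> U) uniformity)"

instance
proof
  fix p q r :: "'a hyp"
  show "dist p q = 0 \<longleftrightarrow> p = q"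
    unfolding dist_hyp_def by (simp add: lorentz_ge_1 lorentz_eq_1_iff)
  define a where "a = lorentz (hyp_coords p) (hyp_coords r)"
  define b where "b = lorentz (hyp_coords r) (hyp_coords q)"
  have ab: "a \<ge> 1" "b \<ge> 1"
    unfolding a_def b_def by (rule lorentz_ge_1)+
  have "lorentz (hyp_coords p) (hyp_coords q) \<le> cosh (arcosh a + arcosh b)"
    using lorentz_le_cosh_add[OF a_def b_def] ab
    by (simp add: cosh_add sinh_arcosh_real)
  then have "dist p q \<le> arcosh (cosh (arcosh a + arcosh b))"
    unfolding dist_hyp_def
    by (metis arcosh_less_iff_real cosh_real_ge_1 linorder_not_less lorentz_ge_1)
  also have "\<dots> = arcosh a + arcosh b"
    using ab by (intro arcosh_cosh_real) auto
  also have "\<dots> = dist p r + dist q r"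
    by (simp add: dist_hyp_def a_def b_def lorentz_commute)
  finally show "dist p q \<le> dist p r + dist q r" .
qed (simp_all add: uniformity_hyp_def open_hyp_def)

end

lemma cosh_dist_hyp: "cosh (dist p q) = lorentz (hyp_coords p) (hyp_coords q)" for p q :: "'n::finite hyp"
  by (simp add: dist_hyp_def lorentz_ge_1)

text \<open>
  The hyperboloid is the graph of \<open>x \<mapsto> sqrt (1 + |x|\<^sup>2)\<close> in Minkowski space, with induced metric
  tensor \<open>g = I - x x\<^sup>T / (1 + |x|\<^sup>2)\<close>, so \<open>sqrt (det g) = 1 / sqrt (1 + |x|\<^sup>2)\<close>.
\<close>

definition hyp_chart :: "real^'n \<Rightarrow> 'n::finite hyp"
  where "hyp_chart x = Abs_hyp (x, sqrt (1 + (norm x)\<^sup>2))"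

definition hyp_volume :: "'n::finite hyp measure"
  where "hyp_volume = distr (density lborel (\<lambda>x. ennreal (1 / sqrt (1 + (norm x)\<^sup>2)))) borel hyp_chart"

lemma hyp_coords_chart [simp]: "hyp_coords (hyp_chart x) = (x, sqrt (1 + (norm x)\<^sup>2))"
proof -
  have "1 + (norm x)\<^sup>2 > 0" by (simp add: add_pos_nonneg)
  then show ?thesis
    unfolding hyp_chart_def by (subst Abs_hyp_inverse) (auto simp: lorentz_def dot_square_norm)
qed

lemma hyp_chart_coords [simp]: "hyp_chart (fst (hyp_coords p)) = p"
  by (simp add: hyp_coords_inject[symmetric] prod_eq_iff snd_hyp_coords dot_square_norm)

lemma continuous_on_hyp_chart: "continuous_on UNIV (hyp_chart :: real^'n \<Rightarrow> 'n::finite hyp)"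
proof (rule continuous_at_imp_continuous_on, rule ballI)
  fix x :: "real^'n"
  have "((\<lambda>y. dist (hyp_chart y) (hyp_chart x)) \<longlongrightarrow> arcosh 1) (at x)"
  proof -
    have "((\<lambda>y. lorentz (hyp_coords (hyp_chart y)) (hyp_coords (hyp_chart x)))
        \<longlongrightarrow> lorentz (hyp_coords (hyp_chart x)) (hyp_coords (hyp_chart x))) (at x)"
      unfolding lorentz_def hyp_coords_chart fst_conv snd_conv by (intro tendsto_intros)
    then show ?thesis
      unfolding dist_hyp_def hyp_coords_self
      by (intro tendsto_arcosh_strong) (auto intro!: always_eventually lorentz_ge_1 simp del: hyp_coords_chart)
  qed
  then show "isCont (hyp_chart :: _ \<Rightarrow> 'n hyp) x"
    unfolding isCont_def by (subst tendsto_dist_iff) simp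
qed

lemma measurable_hyp_chart [measurable]: "hyp_chart \<in> borel \<rightarrow>\<^sub>M borel"
  by (rule borel_measurable_continuous_onI[OF continuous_on_hyp_chart])

lemma sets_hyp_volume [simp, measurable_cong]: "sets hyp_volume = sets borel"
  and space_hyp_volume [simp]: "space hyp_volume = UNIV"
  by (simp_all add: hyp_volume_def)

lemma hyp_volume_bounded_finite:
  fixes A :: "'n::finite hyp set"
  assumes "bounded A" "A \<in> sets borel"
  shows "emeasure hyp_volume A < \<infinity>"
proof -
  obtain r where r: "A \<subseteq> cball (hyp_chart 0) r"
    using assms(1) unfolding bounded_any_center[of A "hyp_chart 0"] by (auto simp: subset_iff)
  have sub: "x \<in> cball 0 (cosh r)" if "hyp_chart x \<in> A" for x
  proof -
    have d: "dist (hyp_chart 0) (hyp_chart x) \<le> r" using that r by auto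
    have "norm x \<le> sqrt (1 + (norm x)\<^sup>2)" by (rule real_le_rsqrt) simp
    also have "\<dots> = cosh (dist (hyp_chart 0) (hyp_chart x))"
      by (simp add: cosh_dist_hyp lorentz_def)
    also have "\<dots> \<le> cosh r"
      using d zero_le_dist[of "hyp_chart 0" "hyp_chart x"] by (subst cosh_real_nonneg_le_iff) linarith+
    finally show ?thesis by simp
  qed
  have "emeasure hyp_volume A
      = (\<integral>\<^sup>+x. ennreal (1 / sqrt (1 + (norm x)\<^sup>2)) * indicator (hyp_chart -` A) x \<partial>lborel)"
    unfolding hyp_volume_def using assms(2) measurable_sets_borel[OF measurable_hyp_chart assms(2)]
    by (subst emeasure_distr) (simp_all add: emeasure_density)
  also have "\<dots> \<le> (\<integral>\<^sup>+x. indicator (cball 0 (cosh r)) x \<partial>(lborel :: (real^'n) measure))"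
  proof (rule nn_integral_mono)
    fix x :: "real^'n"
    have "1 \<le> sqrt (1 + (norm x)\<^sup>2)" by simp
    moreover have "1 + (norm x)\<^sup>2 > 0" by (simp add: add_pos_nonneg)
    ultimately have "1 / sqrt (1 + (norm x)\<^sup>2) \<le> 1" by (simp add: divide_le_eq_1)
    then have "ennreal (1 / sqrt (1 + (norm x)\<^sup>2)) \<le> 1" by simp
    then show "ennreal (1 / sqrt (1 + (norm x)\<^sup>2)) * indicator (hyp_chart -` A) x
        \<le> indicator (cball 0 (cosh r)) x"
      using sub[of x] by (auto simp: indicator_def)
  qed
  also have "\<dots> < \<infinity>"
    using emeasure_bounded_finite[OF bounded_cball[of "0 :: real^'n" "cosh r"]] by simp
  finally show ?thesis .
qed

definition geodesic_line :: "'n::finite hyp set \<Rightarrow> bool"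
  where "geodesic_line L \<longleftrightarrow> (\<exists>\<gamma> :: real \<Rightarrow> 'n hyp. (\<forall>s t. dist (\<gamma> s) (\<gamma> t) = \<bar>s - t\<bar>) \<and> L = range \<gamma>)"

definition totally_geodesic :: "'n::finite hyp set \<Rightarrow> bool"
  where "totally_geodesic P \<longleftrightarrow>
    (\<forall>L p q. geodesic_line L \<and> p \<in> L \<inter> P \<and> q \<in> L \<inter> P \<and> p \<noteq> q \<longrightarrow> L \<subseteq> P)"

text \<open>
  Since \<open>f\<close> below preserves the ambient distance, its image is already totally geodesic; that
  condition is kept to match the usual wording, and does not shrink the class of planes.
\<close>

definition hyp_plane :: "'n::finite hyp set \<Rightarrow> bool"
  where "hyp_plane P \<longleftrightarrow> totally_geodesic P \<and>
    (\<exists>f :: 2 hyp \<Rightarrow> 'n hyp. (\<forall>p q. dist (f p) (f q) = dist p q) \<and> P = range f)"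


section \<open>Poisson point processes\<close>

text \<open>
  A random locally finite set of points \<open>X\<close> with intensity measure \<open>\<Lambda>\<close>. The Poisson law is spelled out because \<^const>\<open>poisson_pmf\<close> is unspecified at
  rate \<open>0\<close>.
\<close>

locale poisson_process = prob_space M
  for M :: "'w measure" and \<Lambda> :: "'a::metric_space measure" and X :: "'w \<Rightarrow> 'a set" +
  assumes sets_intensity: "sets \<Lambda> = sets borel"
    and intensity_finite: "\<And>A. A \<in> sets borel \<Longrightarrow> bounded A \<Longrightarrow> emeasure \<Lambda> A < \<infinity>"
    and locally_finite: "\<And>\<omega> A. \<omega> \<in> space M \<Longrightarrow> bounded A \<Longrightarrow> finite (X \<omega> \<inter> A)"
    and count_measurable: "\<And>A. A \<in> sets borel \<Longrightarrow> bounded A \<Longrightarrow>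
      (\<lambda>\<omega>. card (X \<omega> \<inter> A)) \<in> M \<rightarrow>\<^sub>M count_space UNIV"
    and count_poisson: "\<And>A k. A \<in> sets borel \<Longrightarrow> bounded A \<Longrightarrow>
      \<P>(\<omega> in M. card (X \<omega> \<inter> A) = k) = exp (- measure \<Lambda> A) * measure \<Lambda> A ^ k / fact k"
    and count_indep: "\<And>\<A>. finite \<A> \<Longrightarrow> disjoint \<A> \<Longrightarrow>
      (\<And>A. A \<in> \<A> \<Longrightarrow> A \<in> sets borel \<and> bounded A) \<Longrightarrow>
      indep_vars (\<lambda>_. count_space UNIV) (\<lambda>A \<omega>. card (X \<omega> \<inter> A)) \<A>"


section \<open>Covered and vacant sets of the Boolean model\<close>

definition covered :: "real \<Rightarrow> 'a::metric_space set \<Rightarrow> 'a set"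
  where "covered R X = (\<Union>x\<in>X. ball x R)"

definition vacant :: "real \<Rightarrow> 'a::metric_space set \<Rightarrow> 'a set"
  where "vacant R X = closure (- covered R X)"

end

theory Submission
  imports Defs
begin

text \<open>
  A plane has far too much room to be covered, or missed, by chance. It suffices to watch one curve
  in it. Along a horocycle of the hyperbolic plane, parametrised by arc length, points at parameters
  \<open>\<sigma>\<close> and \<open>\<tau>\<close> are at a distance \<open>d\<close> with \<open>cosh d = 1 + (\<sigma> - \<tau>)\<^sup>2 / 2\<close>, and every isometric copy of
  the plane contains an isometric copy of such a curve (\<open>hyp_plane_contains_horocycle\<close>). The theorem
  follows from a union bound, in which a polynomial number of curves competes against an
  exponentially small probability.

  Few curves: in Minkowski coordinates the copy of the horocycle is quadratic in the parameter, so it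
  is determined by its values at \<open>0\<close>, \<open>1\<close> and \<open>-1\<close> (\<open>horocyclic_interpolation\<close>), and an error in
  these values grows only quadratically in the parameter. Hence the copies that start in a fixed
  bounded region are approximated, up to a fixed error on the parameter range \<open>[-N, N]\<close>, by a
  number of them that is polynomial in \<open>N\<close> (\<open>horocyclic_net\<close>).

  Small probability: points of the curve at parameters in an arithmetic progression of large step
  are far apart, so the numbers of Poisson points in balls of a fixed radius around \<open>N\<close> of them are
  independent. If the curve is covered, every ball of radius \<open>2 R\<close> centred within \<open>R\<close> of it contains
  a Poisson point; if it is vacant, no ball of radius \<open>R / 2\<close> centred within \<open>R / 2\<close> of it does. As
  the volume of a ball of fixed radius is bounded above and away from \<open>0\<close> uniformly in the centre
  (\<open>hyp_volume_ball_bounds\<close>), either event has probability at most \<open>\<beta> ^ N\<close> for some \<open>\<beta> < 1\<close>, already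
  for \<open>N\<close> such balls along a given curve. Covered and vacant sets are treated together in
  \<open>AE_no_horocycle_with_all_counts\<close>, where the change of radius pays for the approximation.
\<close>

section \<open>Volumes of hyperbolic balls\<close>

abbreviation height :: "real^'n::finite \<Rightarrow> real"
  where "height x \<equiv> sqrt (1 + (norm x)\<^sup>2)"

lemma one_le_height: "1 \<le> height x"
  by simp

lemma height_pos: "0 < height x"
  using one_le_height[of x] by linarith

lemma height_squared: "(height x)\<^sup>2 = 1 + (norm x)\<^sup>2"
  by (simp add: add_nonneg_nonneg)

lemma norm_less_height: "norm x < height x"
  by (rule real_less_rsqrt) simp

lemma dist_hyp_less_iff:
  fixes p q :: "'n::finite hyp"
  assumes "\<rho> > 0"
  shows "dist p q < \<rho> \<longleftrightarrow> lorentz (hyp_coords p) (hyp_coords q) < cosh \<rho>"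
  unfolding cosh_dist_hyp[symmetric] using assms by (simp add: cosh_real_nonneg_less_iff)

lemma vimage_ball_hyp_chart:
  fixes x :: "real^'n::finite"
  assumes "\<rho> > 0"
  shows "hyp_chart -` ball (hyp_chart x) \<rho> = {y. height x * height y - x \<bullet> y < cosh \<rho>}"
  using assms by (auto simp: dist_hyp_less_iff lorentz_def)

text \<open>
  The heights of two points are hyperbolic cosines of their distances from the origin, so
  the triangle inequality bounds their ratio. Here this keeps the volume density
  \<open>1 / height\<close> comparable to a constant on a ball.
\<close>

lemma height_less_of_lorentz_less:
  fixes x y :: "real^'n::finite"
  assumes "height x * height y - x \<bullet> y < C"
  shows "height x < 2 * C * height y"
proof -
  have "x \<bullet> y \<le> norm x * norm y" by (rule norm_cauchy_schwarz)
  also have "\<dots> \<le> height x * norm y"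
    using norm_less_height[of x] by (intro mult_right_mono) auto
  finally have *: "height x * (height y - norm y) < C"
    using assms by (simp add: algebra_simps)
  have sum: "0 < height y + norm y"
    using height_pos[of y] by (simp add: add_pos_nonneg)
  have "(height y - norm y) * (height y + norm y) = 1"
    using height_squared[of y] by (simp add: algebra_simps power2_eq_square)
  then have "height x = height x * (height y - norm y) * (height y + norm y)"
    by (simp add: mult.assoc)
  also have "\<dots> < C * (height y + norm y)"
    using * sum by (rule mult_strict_right_mono)
  also have "\<dots> \<le> C * (2 * height y)"
  proof (rule mult_left_mono)
    show "height y + norm y \<le> 2 * height y" using norm_less_height[of y] by simp
    have "0 \<le> height x * (height y - norm y)"
      using height_pos[of x] norm_less_height[of y] by simp
    then show "0 \<le> C" using * by linarith
  qed
  finally show ?thesis by simp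
qed

lemma unit_direction:
  fixes x :: "real^'n::finite"
  obtains e where "norm e = 1" "x = norm x *\<^sub>R e"
proof (cases "x = 0")
  case True
  then show ?thesis using that[of "axis undefined 1"] by simp
next
  case False
  then show ?thesis using that[of "sgn x"] by (simp add: norm_sgn sgn_div_norm)
qed

lemma norm_orthogonal_part:
  fixes e y :: "'a::real_inner"
  assumes "norm e = 1"
  shows "(norm (y - (y \<bullet> e) *\<^sub>R e))\<^sup>2 = (norm y)\<^sup>2 - (y \<bullet> e)\<^sup>2"
proof -
  have "e \<bullet> e = 1" using assms by (simp add: dot_square_norm)
  then show ?thesis
    unfolding power2_norm_eq_inner
    by (simp add: inner_diff_left inner_diff_right inner_commute power2_eq_square)
qed

lemma emeasure_lborel_ball_translate:
  fixes z :: "'a::euclidean_space"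
  shows "emeasure lborel (ball z r) = emeasure lborel (ball 0 r :: 'a set)"
proof -
  have "emeasure lborel (ball z r) = emeasure (distr lborel borel ((+) z)) (ball z r)"
    by (simp add: lborel_distr_plus)
  also have "\<dots> = emeasure lborel ((+) z -` ball z r)"
    by (subst emeasure_distr) auto
  also have "(+) z -` ball z r = ball 0 r"
    by (auto simp: dist_norm)
  finally show ?thesis .
qed

text \<open>
  In the chart, a hyperbolic ball around \<open>x\<close> is a long ellipsoid: of length proportional to \<open>height x\<close> in
  the radial direction and of bounded width in the orthogonal ones. It is therefore covered by about
  \<open>height x\<close> Euclidean balls of bounded radius, placed along the radial axis.
\<close>

lemma emeasure_chart_ball_upper:
  fixes x :: "real^'n::finite"
  assumes "1 \<le> C"
  shows "emeasure lborel {y. height x * height y - x \<bullet> y < C}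
    \<le> ennreal (7 * C * height x) * emeasure lborel (ball 0 (C + 1) :: (real^'n) set)"
proof -
  define a where "a = norm x"
  define t where "t = height x"
  obtain e where e: "norm e = 1" "x = a *\<^sub>R e" unfolding a_def by (rule unit_direction)
  have t: "t\<^sup>2 = 1 + a\<^sup>2" unfolding t_def a_def by (rule height_squared)
  have t1: "1 \<le> t" unfolding t_def by (rule one_le_height)
  define I where "I = {\<lfloor>- (2 * C * t)\<rfloor>..\<lfloor>2 * C * t\<rfloor>}"
  have Ct: "1 \<le> C * t" using mult_mono[of 1 C 1 t] assms t1 by simp
  have "{y. height x * height y - x \<bullet> y < C} \<subseteq> (\<Union>j\<in>I. ball (of_int j *\<^sub>R e) (C + 1))"
  proof (clarify)
    fix y assume y: "height x * height y - x \<bullet> y < C"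
    define h where "h = y \<bullet> e"
    define s where "s = height y"
    define w where "w = y - h *\<^sub>R e"
    have xy: "x \<bullet> y = a * h" by (simp add: e(2) h_def inner_commute)
    have w: "(norm w)\<^sup>2 = s\<^sup>2 - 1 - h\<^sup>2"
      unfolding w_def h_def s_def norm_orthogonal_part[OF e(1)] height_squared by simp
    \<comment> \<open>Minimising over the component along \<open>e\<close> leaves only the orthogonal part.\<close>
    have "(t * s - a * h)\<^sup>2 = (t * h - a * s)\<^sup>2 + (t\<^sup>2 - a\<^sup>2) * (s\<^sup>2 - h\<^sup>2)"
      by (simp add: power2_eq_square algebra_simps)
    then have "(t * s - a * h)\<^sup>2 = (t * h - a * s)\<^sup>2 + (s\<^sup>2 - h\<^sup>2)"
      unfolding t by simp
    then have "(norm w)\<^sup>2 \<le> (t * s - a * h)\<^sup>2"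
      using zero_le_power2[of "t * h - a * s"] unfolding w by linarith
    moreover have "0 \<le> t * s - a * h"
      using lorentz_ge_1[of "hyp_chart x" "hyp_chart y"]
      by (simp add: lorentz_def t_def s_def xy)
    ultimately have "norm w \<le> t * s - a * h"
      by (rule power2_le_imp_le)
    then have wC: "norm w < C" using y by (simp add: t_def s_def xy)
    have "\<bar>h\<bar> \<le> norm y" unfolding h_def using Cauchy_Schwarz_ineq2[of y e] e(1) by simp
    also have "\<dots> < s" unfolding s_def by (rule norm_less_height)
    also have "s < 2 * C * t"
      using y unfolding s_def t_def
      by (intro height_less_of_lorentz_less) (simp add: inner_commute mult.commute)
    finally have "\<bar>h\<bar> < 2 * C * t" .
    then have "\<lfloor>h\<rfloor> \<in> I" unfolding I_def by (auto intro!: floor_mono)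
    moreover have "y \<in> ball (of_int \<lfloor>h\<rfloor> *\<^sub>R e) (C + 1)"
    proof -
      have "y - of_int \<lfloor>h\<rfloor> *\<^sub>R e = w + (h - of_int \<lfloor>h\<rfloor>) *\<^sub>R e"
        by (simp add: w_def algebra_simps)
      then have "norm (y - of_int \<lfloor>h\<rfloor> *\<^sub>R e) \<le> norm w + \<bar>h - of_int \<lfloor>h\<rfloor>\<bar>"
        using norm_triangle_ineq[of w "(h - of_int \<lfloor>h\<rfloor>) *\<^sub>R e"] e(1) by simp
      also have "\<bar>h - of_int \<lfloor>h\<rfloor>\<bar> \<le> 1" by linarith
      finally show ?thesis using wC by (simp add: dist_norm norm_minus_commute)
    qed
    ultimately show "y \<in> (\<Union>j\<in>I. ball (of_int j *\<^sub>R e) (C + 1))" by blast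
  qed
  then have "emeasure lborel {y. height x * height y - x \<bullet> y < C}
      \<le> emeasure lborel (\<Union>j\<in>I. ball (of_int j *\<^sub>R e) (C + 1))"
    by (rule emeasure_mono) (auto simp: I_def)
  also have "\<dots> \<le> (\<Sum>j\<in>I. emeasure lborel (ball (of_int j *\<^sub>R e) (C + 1)))"
    by (rule emeasure_subadditive_finite) (auto simp: I_def)
  also have "\<dots> = ennreal (of_nat (card I)) * emeasure lborel (ball 0 (C + 1) :: (real^'n) set)"
    unfolding emeasure_lborel_ball_translate[of "of_int _ *\<^sub>R e"] sum_constant
      ennreal_of_nat_eq_real_of_nat ..
  also have "\<dots> \<le> ennreal (7 * C * height x) * emeasure lborel (ball 0 (C + 1) :: (real^'n) set)"
  proof (intro mult_right_mono ennreal_leI)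
    have "real (card I) \<le> 4 * (C * t) + 3"
    proof -
      have "0 \<le> \<lfloor>2 * C * t\<rfloor> - \<lfloor>- (2 * C * t)\<rfloor> + 1"
        using Ct by linarith
      then have "real (card I) = of_int (\<lfloor>2 * C * t\<rfloor> - \<lfloor>- (2 * C * t)\<rfloor> + 1)"
        by (simp add: I_def)
      also have "\<dots> \<le> 4 * (C * t) + 3" by linarith
      finally show ?thesis .
    qed
    then show "real (card I) \<le> 7 * C * height x"
      using Ct by (simp add: t_def)
  qed simp
  finally show ?thesis .
qed

text \<open>
  Conversely, the ellipsoid contains about \<open>height x\<close> disjoint Euclidean balls, placed along its
  radial axis.
\<close>

lemma emeasure_chart_ball_lower:
  fixes x :: "real^'n::finite"
  assumes "0 < \<eta>"
  shows "ennreal (height x / 2) * emeasure lborel (ball 0 (min (1/8) \<eta>) :: (real^'n) set)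
    \<le> emeasure lborel {y. height x * height y - x \<bullet> y < 1 + \<eta>}"
proof -
  \<comment> \<open>Small enough for \<open>4 \<eta> c + 4 c\<^sup>2 + c\<^sup>2 < 2 \<eta>\<close>, which is what the last estimate needs.\<close>
  define c where "c = min (1/8) \<eta>"
  have c: "0 < c" "c \<le> 1/8" "c \<le> \<eta>" using assms by (auto simp: c_def)
  define a where "a = norm x"
  define t where "t = height x"
  obtain e where e: "norm e = 1" "x = a *\<^sub>R e" unfolding a_def by (rule unit_direction)
  have t: "t\<^sup>2 = 1 + a\<^sup>2" unfolding t_def a_def by (rule height_squared)
  have t1: "1 \<le> t" unfolding t_def by (rule one_le_height)
  have a: "0 \<le> a" "a \<le> t" using norm_less_height[of x] by (auto simp: a_def t_def)
  define J where "J = nat \<lfloor>t / 2\<rfloor>"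
  define z where "z j = x + (2 * c * real j) *\<^sub>R e" for j
  have sub: "(\<Union>j\<in>{..J}. ball (z j) c) \<subseteq> {y. height x * height y - x \<bullet> y < 1 + \<eta>}"
  proof (intro UN_least subsetI CollectI)
    fix j y assume j: "j \<in> {..J}" and y: "y \<in> ball (z j) c"
    define v where "v = y - z j"
    have v: "norm v < c" using y by (simp add: v_def dist_norm norm_minus_commute)
    define k where "k = 2 * c * real j + v \<bullet> e"
    define s where "s = height y"
    have ye: "y = (a + 2 * c * real j) *\<^sub>R e + v"
      by (simp add: v_def z_def e(2) algebra_simps)
    have ee: "e \<bullet> e = 1" using e(1) by (simp add: dot_square_norm)
    have h: "y \<bullet> e = a + k" by (simp add: ye k_def inner_add_left ee)
    have xy: "x \<bullet> y = a * (a + k)" using h by (simp add: e(2) inner_commute)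
    have "real j \<le> t / 2" using j t1 unfolding J_def by (simp add: le_nat_iff le_floor_iff)
    then have "c * (2 * real j) \<le> c * t" using c by (intro mult_left_mono) auto
    moreover have "0 \<le> c * (2 * real j)" using c by simp
    moreover have "\<bar>v \<bullet> e\<bar> \<le> c" using Cauchy_Schwarz_ineq2[of v e] e(1) v by simp
    moreover have "c \<le> c * t" using c t1 by simp
    ultimately have k: "\<bar>k\<bar> \<le> 2 * c * t"
      unfolding k_def by (simp only: abs_le_iff mult.assoc mult.left_commute[of 2 c]) linarith
    have s: "s\<^sup>2 \<le> 1 + (a + k)\<^sup>2 + c\<^sup>2"
    proof -
      have "y - (y \<bullet> e) *\<^sub>R e = v - (v \<bullet> e) *\<^sub>R e"
        unfolding h by (simp add: ye k_def algebra_simps)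
      then have "(norm y)\<^sup>2 - (y \<bullet> e)\<^sup>2 = (norm v)\<^sup>2 - (v \<bullet> e)\<^sup>2"
        using norm_orthogonal_part[OF e(1), of y] norm_orthogonal_part[OF e(1), of v] by simp
      also have "\<dots> \<le> c\<^sup>2"
        using power_mono[of "norm v" c 2] v zero_le_power2[of "v \<bullet> e"] norm_ge_zero[of v]
        by linarith
      finally show ?thesis unfolding s_def height_squared h by simp
    qed
    have kt: "\<bar>a * k\<bar> \<le> 2 * c * t\<^sup>2"
    proof -
      have "\<bar>a * k\<bar> = a * \<bar>k\<bar>" using a by (simp add: abs_mult)
      also have "\<dots> \<le> t * (2 * c * t)" using a k t1 by (intro mult_mono) auto
      finally show ?thesis by (simp add: power2_eq_square mult_ac)
    qed
    have k2: "k\<^sup>2 \<le> 4 * c\<^sup>2 * t\<^sup>2"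
      using power_mono[OF k, of 2] by (simp add: power_mult_distrib)
    have cc: "c\<^sup>2 \<le> \<eta> / 8"
      unfolding power2_eq_square using mult_mono[of c "1/8" c \<eta>] c by simp
    have pos: "0 < 1 + \<eta> + a * (a + k)"
    proof -
      have "2 * c * t\<^sup>2 \<le> 1 * t\<^sup>2" using c by (intro mult_right_mono) auto
      then have "- (a * k) \<le> 1 + a\<^sup>2"
        using kt abs_ge_minus_self[of "a * k"] unfolding t[symmetric] by linarith
      moreover have "a * (a + k) = a\<^sup>2 + a * k" by (simp add: power2_eq_square distrib_left)
      ultimately show ?thesis using assms by linarith
    qed
    \<comment> \<open>Squaring removes the two roots in the heights; what remains is a polynomial inequality.\<close>
    have "(t * s)\<^sup>2 \<le> t\<^sup>2 * (1 + (a + k)\<^sup>2 + c\<^sup>2)"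
      unfolding power_mult_distrib using s by (intro mult_left_mono) auto
    also have "\<dots> < (1 + \<eta> + a * (a + k))\<^sup>2"
    proof -
      have "(1 + \<eta> + a * (a + k))\<^sup>2 - (1 + a\<^sup>2) * (1 + (a + k)\<^sup>2 + c\<^sup>2)
          = \<eta>\<^sup>2 + 2 * \<eta> * (1 + a\<^sup>2) + 2 * \<eta> * (a * k) - k\<^sup>2 - c\<^sup>2 * (1 + a\<^sup>2)"
        by (simp add: power2_eq_square algebra_simps)
      also have "\<dots> = \<eta>\<^sup>2 + 2 * \<eta> * t\<^sup>2 + 2 * \<eta> * (a * k) - k\<^sup>2 - c\<^sup>2 * t\<^sup>2"
        unfolding t ..
      also have "\<dots> > 0"
      proof -
        have "2 * \<eta> * (- (a * k)) \<le> 2 * \<eta> * (2 * c * t\<^sup>2)"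
          using kt assms by (intro mult_left_mono) (auto simp: abs_le_iff)
        also have "\<dots> \<le> 2 * \<eta> * (2 * (1/8) * t\<^sup>2)"
          using c assms by (intro mult_left_mono mult_right_mono) auto
        finally have 1: "- (2 * \<eta> * (a * k)) \<le> \<eta> * t\<^sup>2 / 2" by simp
        have 2: "c\<^sup>2 * t\<^sup>2 \<le> \<eta> / 8 * t\<^sup>2" using cc by (rule mult_right_mono) simp
        have "0 < \<eta> * t\<^sup>2" using assms t1 by simp
        moreover have "0 \<le> \<eta>\<^sup>2" by simp
        ultimately show ?thesis using 1 2 k2 by linarith
      qed
      finally show ?thesis unfolding t by simp
    qed
    finally have "t * s < 1 + \<eta> + a * (a + k)"
      by (rule power_less_imp_less_base) (rule less_imp_le[OF pos])
    then show "height x * height y - x \<bullet> y < 1 + \<eta>"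
      unfolding xy s_def t_def by simp
  qed
  have disj: "disjoint_family_on (\<lambda>j. ball (z j) c) {..J}"
    unfolding disjoint_family_on_def
  proof (intro ballI impI)
    fix i j :: nat assume "i \<noteq> j"
    have "z i - z j = (2 * c * (real i - real j)) *\<^sub>R e"
      by (simp add: z_def algebra_simps)
    then have "dist (z i) (z j) = 2 * c * \<bar>real i - real j\<bar>"
      using e(1) c by (simp add: dist_norm abs_mult)
    moreover have "1 \<le> \<bar>real i - real j\<bar>" using \<open>i \<noteq> j\<close> by linarith
    ultimately have "2 * c \<le> dist (z i) (z j)" using c by simp
    then show "ball (z i) c \<inter> ball (z j) c = {}"
      by (intro disjoint_ballI) simp
  qed
  have "ennreal (t / 2) * emeasure lborel (ball 0 c :: (real^'n) set)
      \<le> ennreal (real (card {..J})) * emeasure lborel (ball 0 c :: (real^'n) set)"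
    by (intro mult_right_mono ennreal_leI) (simp_all add: J_def, linarith)
  also have "\<dots> = (\<Sum>j\<in>{..J}. emeasure lborel (ball (z j) c))"
    unfolding emeasure_lborel_ball_translate[of "z _"] sum_constant ennreal_of_nat_eq_real_of_nat ..
  also have "\<dots> = emeasure lborel (\<Union>j\<in>{..J}. ball (z j) c)"
    by (rule sum_emeasure[OF _ disj]) auto
  also have "\<dots> \<le> emeasure lborel {y. height x * height y - x \<bullet> y < 1 + \<eta>}"
    by (rule emeasure_mono[OF sub]) simp
  finally show ?thesis unfolding t_def c_def .
qed

lemma emeasure_hyp_volume_eq:
  fixes A :: "'n::finite hyp set"
  assumes "A \<in> sets borel"
  shows "emeasure hyp_volume A
    = (\<integral>\<^sup>+y. ennreal (1 / height y) * indicator (hyp_chart -` A) y \<partial>lborel)"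
  unfolding hyp_volume_def using assms measurable_sets_borel[OF measurable_hyp_chart assms]
  by (subst emeasure_distr) (simp_all add: emeasure_density)

text \<open>
  Hyperbolic volume is invariant under isometries, so balls of radius \<open>\<rho>\<close> all have the same
  volume. Two-sided bounds are enough here and are cheaper: the Lebesgue measure of the chart
  image is proportional to \<open>height x\<close> up to constants, the density is proportional to
  \<open>1 / height x\<close>, and the two factors cancel.
\<close>

lemma hyp_volume_ball_bounds:
  assumes "0 < \<rho>"
  obtains v V where "0 < v"
    "\<And>p :: 'n::finite hyp. v \<le> measure hyp_volume (ball p \<rho>)"
    "\<And>p :: 'n::finite hyp. measure hyp_volume (ball p \<rho>) \<le> V"
proof -
  define C where "C = cosh \<rho>"
  define \<eta> where "\<eta> = C - 1"
  have C: "1 < C" using assms cosh_real_strict_mono[of 0 \<rho>] by (simp add: C_def)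
  then have \<eta>: "0 < \<eta>" by (simp add: \<eta>_def)
  define b where "b = measure lborel (ball 0 (min (1/8) \<eta>) :: (real^'n) set)"
  define B where "B = measure lborel (ball 0 (C + 1) :: (real^'n) set)"
  have fin: "emeasure lborel (ball 0 r :: (real^'n) set) = ennreal (measure lborel (ball 0 r :: (real^'n) set))" for r
    by (intro emeasure_eq_ennreal_measure) (metis emeasure_lborel_ball_finite infinity_ennreal_def less_irrefl)
  have b: "0 < b" unfolding b_def using \<eta> by (simp add: content_ball_pos)
  have B: "0 \<le> B" by (simp add: B_def)
  have main: "ennreal (b / (4 * C)) \<le> emeasure hyp_volume (ball p \<rho>)
      \<and> emeasure hyp_volume (ball p \<rho>) \<le> ennreal (14 * C\<^sup>2 * B)" for p :: "'n hyp"
  proof -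
    define x where "x = fst (hyp_coords p)"
    define t where "t = height x"
    have t: "1 \<le> t" unfolding t_def by (rule one_le_height)
    have p: "p = hyp_chart x" by (simp add: x_def)
    define S where "S = {y. height x * height y - x \<bullet> y < C}"
    have S: "hyp_chart -` ball p \<rho> = S"
      unfolding p S_def C_def using assms by (rule vimage_ball_hyp_chart)
    have mS [measurable]: "S \<in> sets borel" unfolding S_def by measurable
    have eq: "emeasure hyp_volume (ball p \<rho>) = (\<integral>\<^sup>+y. ennreal (1 / height y) * indicator S y \<partial>lborel)"
      by (subst emeasure_hyp_volume_eq) (simp_all add: S)
    have lo: "1 / (2 * C * t) \<le> 1 / height y" and hi: "1 / height y \<le> 2 * C / t" if "y \<in> S" for y
    proof -
      have y: "height x * height y - x \<bullet> y < C" using that by (simp add: S_def)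
      have "height y < 2 * C * t"
        using y unfolding t_def
        by (intro height_less_of_lorentz_less) (simp add: inner_commute mult.commute)
      then show "1 / (2 * C * t) \<le> 1 / height y"
        using height_pos[of y] C t by (intro divide_left_mono) (auto intro!: mult_pos_pos)
      have "t < 2 * C * height y"
        using y unfolding t_def by (rule height_less_of_lorentz_less)
      then show "1 / height y \<le> 2 * C / t"
        using height_pos[of y] t by (simp add: field_simps)
    qed
    have "ennreal (b / (4 * C)) = ennreal (1 / (2 * C * t)) * (ennreal (t / 2) * ennreal b)"
      using t C b by (simp add: ennreal_mult'[symmetric])
    also have "\<dots> \<le> ennreal (1 / (2 * C * t)) * emeasure lborel S"
      using emeasure_chart_ball_lower[OF \<eta>, of x] unfolding fin b_def S_def t_def
      by (intro mult_left_mono) (simp_all add: \<eta>_def)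
    also have "\<dots> = (\<integral>\<^sup>+y. ennreal (1 / (2 * C * t)) * indicator S y \<partial>lborel)"
      by (simp add: nn_integral_cmult_indicator)
    also have "\<dots> \<le> emeasure hyp_volume (ball p \<rho>)"
      unfolding eq using lo by (intro nn_integral_mono) (auto simp: indicator_def intro!: ennreal_leI)
    finally have 1: "ennreal (b / (4 * C)) \<le> emeasure hyp_volume (ball p \<rho>)" .
    have "emeasure hyp_volume (ball p \<rho>) \<le> (\<integral>\<^sup>+y. ennreal (2 * C / t) * indicator S y \<partial>lborel)"
      unfolding eq using hi by (intro nn_integral_mono) (auto simp: indicator_def intro!: ennreal_leI)
    also have "\<dots> = ennreal (2 * C / t) * emeasure lborel S"
      by (simp add: nn_integral_cmult_indicator)
    also have "\<dots> \<le> ennreal (2 * C / t) * (ennreal (7 * C * t) * ennreal B)"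
      using emeasure_chart_ball_upper[of C x] C unfolding fin B_def S_def t_def
      by (intro mult_left_mono) simp_all
    also have "\<dots> = ennreal (14 * C\<^sup>2 * B)"
      using t C B by (simp add: ennreal_mult'[symmetric] power2_eq_square)
    finally show ?thesis using 1 by simp
  qed
  show thesis
  proof (rule that)
    show "0 < b / (4 * C)" using b C by simp
    fix p :: "'n hyp"
    show "measure hyp_volume (ball p \<rho>) \<le> 14 * C\<^sup>2 * B"
      unfolding measure_def using main[of p] B C by (intro enn2real_leI) auto
    have "emeasure hyp_volume (ball p \<rho>) < top"
      using hyp_volume_bounded_finite[of "ball p \<rho>"] by simp
    then have "enn2real (ennreal (b / (4 * C))) \<le> measure hyp_volume (ball p \<rho>)"
      unfolding measure_def using main[of p] by (intro enn2real_mono) auto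
    then show "b / (4 * C) \<le> measure hyp_volume (ball p \<rho>)"
      using b C by simp
  qed
qed

section \<open>Horocycles\<close>

lemma lorentz_add_left: "lorentz (p + q) r = lorentz p r + lorentz q r"
  and lorentz_diff_left: "lorentz (p - q) r = lorentz p r - lorentz q r"
  and lorentz_scaleR_left: "lorentz (c *\<^sub>R p) r = c * lorentz p r"
  by (simp_all add: lorentz_def inner_add_left inner_diff_left algebra_simps)

text \<open>
  The Lorentz form is definite on the orthogonal complement of a timelike vector. It lets linear
  relations between points be checked on their Lorentz products, although the points may span only
  a subspace.
\<close>

lemma null_orthogonal_to_timelike_eq_0:
  assumes null: "lorentz v v = 0" and orth: "lorentz v (hyp_coords p) = 0"
  shows "v = 0"
proof -
  obtain x s y t where vp [simp]: "v = (x, s)" "hyp_coords p = (y, t)"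
    by (metis surj_pair)
  have "\<bar>s\<bar> = norm x"
  proof (rule power2_eq_imp_eq)
    show "\<bar>s\<bar>\<^sup>2 = (norm x)\<^sup>2"
      using null by (simp add: lorentz_def power2_norm_eq_inner) (simp add: power2_eq_square)
  qed auto
  moreover have "t > norm y" using snd_hyp_coords_gt[of p] by simp
  moreover have "\<bar>s\<bar> * t \<le> norm x * norm y"
  proof -
    have "\<bar>s\<bar> * t = \<bar>s * t\<bar>"
      using hyp_coords_pos[of p] by (simp add: abs_mult)
    also have "s * t = x \<bullet> y" using orth by (simp add: lorentz_def)
    also have "\<bar>x \<bullet> y\<bar> \<le> norm x * norm y" by (rule Cauchy_Schwarz_ineq2)
    finally show ?thesis .
  qed
  ultimately have "norm x * (t - norm y) \<le> 0" by (simp add: algebra_simps)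
  with \<open>t > norm y\<close> have "norm x = 0"
    by (metis diff_gt_0_iff_gt norm_ge_zero order_antisym zero_le_mult_iff mult_le_0_iff not_le)
  with \<open>\<bar>s\<bar> = norm x\<close> show ?thesis by (simp add: zero_prod_def)
qed

text \<open>
  The last coordinates enter the Lorentz form of a difference with the helpful sign, so they can be
  dropped: closeness in the chart implies hyperbolic closeness.
\<close>

lemma cosh_dist_le_fst:
  "cosh (dist p q) \<le> 1 + (norm (fst (hyp_coords p) - fst (hyp_coords q)))\<^sup>2 / 2"
proof -
  obtain x s y t where [simp]: "hyp_coords p = (x, s)" "hyp_coords q = (y, t)"
    by (metis surj_pair)
  have "s\<^sup>2 = 1 + x \<bullet> x" "t\<^sup>2 = 1 + y \<bullet> y"
    using hyp_coords_self'[of p] hyp_coords_self'[of q] by simp_all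
  moreover have "2 * (s * t) \<le> s\<^sup>2 + t\<^sup>2"
    using zero_le_power2[of "s - t"] by (simp add: power2_eq_square algebra_simps)
  ultimately show ?thesis
    unfolding cosh_dist_hyp power2_norm_eq_inner
    by (simp add: lorentz_def inner_diff_left inner_diff_right inner_commute[of y x] field_simps)
qed

text \<open>
  Only the mutual distances are recorded, so the notion is preserved by isometric embeddings.
\<close>

definition horocyclic :: "(real \<Rightarrow> 'n::finite hyp) \<Rightarrow> bool"
  where "horocyclic \<gamma> \<longleftrightarrow> (\<forall>\<sigma> \<tau>. cosh (dist (\<gamma> \<sigma>) (\<gamma> \<tau>)) = 1 + (\<sigma> - \<tau>)\<^sup>2 / 2)"

text \<open>
  The curve \<open>\<tau> \<mapsto> (\<tau>, \<tau>\<^sup>2 / 2, 1 + \<tau>\<^sup>2 / 2)\<close> is a horocycle of the hyperbolic plane.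
\<close>

lemma hyp_plane_contains_horocycle:
  fixes P :: "'n::finite hyp set"
  assumes "hyp_plane P"
  obtains \<gamma> where "horocyclic \<gamma>" "range \<gamma> \<subseteq> P"
proof -
  obtain f :: "2 hyp \<Rightarrow> 'n hyp" where f: "\<And>p q. dist (f p) (f q) = dist p q" "P = range f"
    using assms unfolding hyp_plane_def by metis
  define x :: "real \<Rightarrow> real^2" where "x \<tau> = vector [\<tau>, \<tau>\<^sup>2 / 2]" for \<tau>
  have inner: "x \<sigma> \<bullet> x \<tau> = \<sigma> * \<tau> + \<sigma>\<^sup>2 * \<tau>\<^sup>2 / 4" for \<sigma> \<tau>
    by (simp add: x_def inner_vec_def sum_2)
  have height: "sqrt (1 + (norm (x \<tau>))\<^sup>2) = 1 + \<tau>\<^sup>2 / 2" for \<tau>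
  proof (rule real_sqrt_unique)
    show "(1 + \<tau>\<^sup>2 / 2)\<^sup>2 = 1 + (norm (x \<tau>))\<^sup>2"
      unfolding power2_norm_eq_inner inner by (simp add: power2_eq_square algebra_simps)
  qed (simp add: add_nonneg_nonneg)
  have "horocyclic (\<lambda>\<tau>. f (hyp_chart (x \<tau>)))"
    unfolding horocyclic_def f(1) cosh_dist_hyp lorentz_def hyp_coords_chart fst_conv snd_conv
      height inner
    by (auto simp: power2_eq_square field_simps)
  then show ?thesis by (rule that) (auto simp: f(2))
qed

text \<open>
  Lagrange interpolation at the nodes \<open>0\<close>, \<open>1\<close>, \<open>-1\<close>. The error vector is orthogonal to every
  point of the curve, because Lorentz products along the curve are quadratic polynomials and
  interpolation is exact for these. The error is then also orthogonal to itself, hence \<open>0\<close>.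
\<close>

lemma horocyclic_interpolation:
  assumes "horocyclic \<gamma>"
  shows "hyp_coords (\<gamma> \<tau>) = (1 - \<tau>\<^sup>2) *\<^sub>R hyp_coords (\<gamma> 0)
    + ((\<tau>\<^sup>2 + \<tau>) / 2) *\<^sub>R hyp_coords (\<gamma> 1) + ((\<tau>\<^sup>2 - \<tau>) / 2) *\<^sub>R hyp_coords (\<gamma> (-1))"
proof -
  define h where "h \<sigma> = hyp_coords (\<gamma> \<sigma>)" for \<sigma>
  define u where "u = (1 - \<tau>\<^sup>2) *\<^sub>R h 0 + ((\<tau>\<^sup>2 + \<tau>) / 2) *\<^sub>R h 1 + ((\<tau>\<^sup>2 - \<tau>) / 2) *\<^sub>R h (-1)"
  have hh: "lorentz (h \<sigma>) (h \<tau>) = 1 + (\<sigma> - \<tau>)\<^sup>2 / 2" for \<sigma> \<tau>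
    using assms unfolding horocyclic_def cosh_dist_hyp h_def by blast
  have orth: "lorentz (h \<tau> - u) (h \<sigma>) = 0" for \<sigma>
    unfolding u_def lorentz_diff_left lorentz_add_left lorentz_scaleR_left hh
    by (simp add: power2_eq_square field_simps)
  have "lorentz w (h \<tau> - u) = 0" if "\<And>\<sigma>. lorentz w (h \<sigma>) = 0" for w
    using that unfolding lorentz_commute[of w] u_def
    by (simp add: lorentz_diff_left lorentz_add_left lorentz_scaleR_left)
  then have "lorentz (h \<tau> - u) (h \<tau> - u) = 0" using orth by blast
  moreover have "lorentz (h \<tau> - u) (hyp_coords (\<gamma> 0)) = 0" using orth[of 0] by (simp only: h_def)
  ultimately have "h \<tau> - u = 0" by (rule null_orthogonal_to_timelike_eq_0)
  then show ?thesis by (simp add: u_def h_def)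
qed

text \<open>
  By interpolation, a bound at the three nodes confines the whole curve on bounded parameter
  ranges. The bound is a natural number so that countably many cases exhaust all curves.
\<close>

definition horocyclic_within :: "nat \<Rightarrow> (real \<Rightarrow> 'n::finite hyp) \<Rightarrow> bool"
  where "horocyclic_within K \<gamma> \<longleftrightarrow>
    horocyclic \<gamma> \<and> (\<forall>i\<in>{0, 1, -1}. norm (fst (hyp_coords (\<gamma> i))) \<le> real K)"

lemma horocyclic_imp_within:
  assumes "horocyclic \<gamma>"
  obtains K where "horocyclic_within K \<gamma>"
proof -
  define b where "b = (\<Sum>i\<in>{0, 1, -1}. norm (fst (hyp_coords (\<gamma> i))))"
  obtain K where "b \<le> real K" using real_arch_simple by blast
  moreover have "norm (fst (hyp_coords (\<gamma> i))) \<le> b" if "i \<in> {0, 1, -1}" for i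
    unfolding b_def using that by (intro member_le_sum) auto
  ultimately have "horocyclic_within K \<gamma>"
    using assms unfolding horocyclic_within_def by (meson order_trans)
  then show ?thesis by (rule that)
qed

text \<open>
  The weights of the interpolation have absolute sum at most \<open>3 (N + 1)\<^sup>2\<close> for
  \<open>\<bar>\<tau>\<bar> \<le> N\<close>, which bounds the loss from the nodes to \<open>\<tau>\<close>.
\<close>

lemma horocyclic_close:
  fixes \<gamma> \<gamma>' :: "real \<Rightarrow> 'n::finite hyp"
  assumes "horocyclic \<gamma>" "horocyclic \<gamma>'" "0 < \<epsilon>" "\<bar>\<tau>\<bar> \<le> N"
    and close: "\<And>i. i \<in> {0, 1, -1} \<Longrightarrow>
      3 * (N + 1)\<^sup>2 * norm (fst (hyp_coords (\<gamma> i)) - fst (hyp_coords (\<gamma>' i))) \<le> sqrt (cosh \<epsilon> - 1)"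
  shows "dist (\<gamma> \<tau>) (\<gamma>' \<tau>) < \<epsilon>"
proof -
  define d where "d i = fst (hyp_coords (\<gamma> i)) - fst (hyp_coords (\<gamma>' i))" for i
  have N: "0 \<le> N" using assms(4) by linarith
  define \<delta> where "\<delta> = sqrt (cosh \<epsilon> - 1) / (3 * (N + 1)\<^sup>2)"
  have d: "norm (d i) \<le> \<delta>" if "i \<in> {0, 1, -1}" for i
    using close[OF that] N by (simp add: \<delta>_def d_def field_simps)
  have c0: "0 < cosh \<epsilon> - 1" using assms(3) cosh_real_strict_mono[of 0 \<epsilon>] by simp
  have \<delta>: "0 \<le> \<delta>" using c0 by (simp add: \<delta>_def)
  have \<tau>: "\<tau>\<^sup>2 \<le> N\<^sup>2" using power_mono[OF assms(4), of 2] by simp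
  have "d \<tau> = (1 - \<tau>\<^sup>2) *\<^sub>R d 0 + ((\<tau>\<^sup>2 + \<tau>) / 2) *\<^sub>R d 1 + ((\<tau>\<^sup>2 - \<tau>) / 2) *\<^sub>R d (-1)"
    unfolding d_def horocyclic_interpolation[OF assms(1), of \<tau>] horocyclic_interpolation[OF assms(2), of \<tau>]
    by (simp add: algebra_simps)
  then have "norm (d \<tau>) \<le> \<bar>1 - \<tau>\<^sup>2\<bar> * norm (d 0) + \<bar>(\<tau>\<^sup>2 + \<tau>) / 2\<bar> * norm (d 1)
      + \<bar>(\<tau>\<^sup>2 - \<tau>) / 2\<bar> * norm (d (-1))"
    by (metis (no_types, lifting) add_mono_thms_linordered_semiring(3) norm_scaleR norm_triangle_le norm_triangle_ineq)
  also have "\<dots> \<le> (1 + N\<^sup>2) * \<delta> + ((N\<^sup>2 + N) / 2) * \<delta> + ((N\<^sup>2 + N) / 2) * \<delta>"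
  proof (intro add_mono mult_mono d)
    show "\<bar>1 - \<tau>\<^sup>2\<bar> \<le> 1 + N\<^sup>2" using \<tau> zero_le_power2[of \<tau>] by linarith
    have "\<bar>q + u\<bar> \<le> r + N" if "0 \<le> q" "q \<le> r" "\<bar>u\<bar> \<le> N" for q r u :: real
      using that by linarith
    from this[of "\<tau>\<^sup>2" "N\<^sup>2" \<tau>] this[of "\<tau>\<^sup>2" "N\<^sup>2" "- \<tau>"]
    have "\<bar>\<tau>\<^sup>2 + \<tau>\<bar> \<le> N\<^sup>2 + N" "\<bar>\<tau>\<^sup>2 - \<tau>\<bar> \<le> N\<^sup>2 + N"
      using \<tau> assms(4) by simp_all
    then show "\<bar>(\<tau>\<^sup>2 + \<tau>) / 2\<bar> \<le> (N\<^sup>2 + N) / 2" "\<bar>(\<tau>\<^sup>2 - \<tau>) / 2\<bar> \<le> (N\<^sup>2 + N) / 2"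
      by simp_all
  qed (use N in auto)
  also have "\<dots> = (2 * N\<^sup>2 + N + 1) * \<delta>" by (simp add: field_simps)
  also have "\<dots> \<le> (3 * (N + 1)\<^sup>2) * \<delta>"
    using N \<delta> by (intro mult_right_mono) (simp_all add: power2_eq_square algebra_simps)
  also have "\<dots> = sqrt (cosh \<epsilon> - 1)" using N by (simp add: \<delta>_def)
  finally have "(norm (d \<tau>))\<^sup>2 \<le> (sqrt (cosh \<epsilon> - 1))\<^sup>2" by (rule power_mono) simp
  then have "(norm (d \<tau>))\<^sup>2 \<le> cosh \<epsilon> - 1" using c0 by simp
  then have "cosh (dist (\<gamma> \<tau>) (\<gamma>' \<tau>)) < cosh \<epsilon>"
    using cosh_dist_le_fst[of "\<gamma> \<tau>" "\<gamma>' \<tau>"] c0 by (simp add: d_def)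
  then show ?thesis using assms(3) by (simp add: cosh_real_nonneg_less_iff)
qed

text \<open>
  Round the chart coordinates of the three nodes to a grid of mesh \<open>1 / m\<close>, with \<open>m\<close> of order
  \<open>(N + 1)\<^sup>2\<close>, and keep one curve from each occupied cell. The grid has \<open>(2 K m + 1) ^ (3 n)\<close> cells
  in dimension \<open>n\<close>, a polynomial in \<open>N\<close>.
\<close>

lemma horocyclic_net:
  fixes \<epsilon> :: real and K :: nat
  assumes "0 < \<epsilon>"
  obtains c :: real and p :: nat where "0 \<le> c"
    "\<And>N. \<exists>T :: (real \<Rightarrow> 'n::finite hyp) set. finite T \<and> real (card T) \<le> c * (real N + 1) ^ p \<and>
      T \<subseteq> Collect (horocyclic_within K) \<and>
      (\<forall>\<gamma>. horocyclic_within K \<gamma> \<longrightarrow> (\<exists>\<gamma>'\<in>T. \<forall>\<tau>. \<bar>\<tau>\<bar> \<le> real N \<longrightarrow> dist (\<gamma> \<tau>) (\<gamma>' \<tau>) < \<epsilon>))"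
proof -
  define n where "n = CARD('n)"
  define \<delta> where "\<delta> = sqrt (cosh \<epsilon> - 1)"
  have \<delta>: "0 < \<delta>" using assms cosh_real_strict_mono[of 0 \<epsilon>] by (simp add: \<delta>_def)
  obtain a where a: "3 * real n / \<delta> \<le> real a" using real_arch_simple by blast
  have "0 < 3 * real n / \<delta>" using \<delta> by (simp add: n_def)
  with a have a0: "0 < a" by (metis less_le_trans of_nat_0_less_iff)
  define J :: "real set" where "J = {0, 1, -1}"
  have cJ: "finite J" "card J = 3" by (simp_all add: J_def)
  show thesis
  proof (rule that)
    show "0 \<le> (2 * real K * real a + 1) ^ (3 * n)" by simp
    fix N :: nat
    \<comment> \<open>The square offsets the quadratic loss of the interpolation; \<open>a\<close> depends on \<open>\<epsilon>\<close> and the dimension only.\<close>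
    define m where "m = a * (N + 1)\<^sup>2"
    have m: "0 < m" using a0 by (simp add: m_def)
    define G :: "(real \<Rightarrow> 'n hyp) set" where "G = Collect (horocyclic_within K)"
    define cell :: "(real \<Rightarrow> 'n hyp) \<Rightarrow> real \<times> 'n \<Rightarrow> int"
      where "cell \<gamma> = restrict (\<lambda>(i, k). \<lfloor>fst (hyp_coords (\<gamma> i)) $ k * real m\<rfloor>) (J \<times> UNIV)" for \<gamma>
    define B where "B = (J \<times> (UNIV :: 'n set)) \<rightarrow>\<^sub>E {- int (K * m)..int (K * m)}"
    have finB: "finite B" unfolding B_def using cJ by (intro finite_PiE) auto
    have cardB: "card B = (2 * (K * m) + 1) ^ (3 * n)"
      unfolding B_def using cJ by (subst card_PiE) (auto simp: n_def nat_add_distrib nat_mult_distrib)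
    have cellB: "cell ` G \<subseteq> B"
    proof (clarify)
      fix \<gamma> assume "\<gamma> \<in> G"
      have "\<lfloor>fst (hyp_coords (\<gamma> i)) $ k * real m\<rfloor> \<in> {- int (K * m)..int (K * m)}" if "i \<in> J" for i k
      proof -
        have "norm (fst (hyp_coords (\<gamma> i))) \<le> real K"
          using \<open>\<gamma> \<in> G\<close> that by (auto simp: G_def J_def horocyclic_within_def)
        then have "\<bar>fst (hyp_coords (\<gamma> i)) $ k\<bar> \<le> real K"
          using component_le_norm_cart[of "fst (hyp_coords (\<gamma> i))" k] by linarith
        then have "\<bar>fst (hyp_coords (\<gamma> i)) $ k\<bar> * real m \<le> real K * real m"
          by (rule mult_right_mono) simp
        then have "\<bar>fst (hyp_coords (\<gamma> i)) $ k * real m\<bar> \<le> of_int (int (K * m))"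
          by (simp add: abs_mult)
        then show ?thesis unfolding atLeastAtMost_iff abs_le_iff by linarith
      qed
      then show "cell \<gamma> \<in> B" unfolding B_def cell_def by auto
    qed
    define T where "T = inv_into G cell ` (cell ` G)"
    have fin: "finite (cell ` G)" using finite_subset[OF cellB finB] .
    have "finite T" using fin by (simp add: T_def)
    moreover have "T \<subseteq> G" unfolding T_def by (auto intro: inv_into_into)
    moreover have "real (card T) \<le> (2 * real K * real a + 1) ^ (3 * n) * (real N + 1) ^ (6 * n)"
    proof -
      have "card T \<le> card B"
        unfolding T_def using card_image_le[OF fin] card_mono[OF finB cellB] by (rule order_trans)
      then have "real (card T) \<le> (2 * real K * real m + 1) ^ (3 * n)"
        unfolding cardB by (metis (mono_tags, lifting) Suc_eq_plus1 mult.assoc of_nat_1 of_nat_add of_nat_le_iff of_nat_mult of_nat_numeral of_nat_power)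
      also have "\<dots> \<le> ((2 * real K * real a + 1) * (real N + 1)\<^sup>2) ^ (3 * n)"
      proof (rule power_mono)
        have "1 \<le> (real N + 1)\<^sup>2" by simp
        then show "2 * real K * real m + 1 \<le> (2 * real K * real a + 1) * (real N + 1)\<^sup>2"
          by (simp add: m_def algebra_simps)
      qed simp
      also have "\<dots> = (2 * real K * real a + 1) ^ (3 * n) * (real N + 1) ^ (6 * n)"
        by (simp add: power_mult_distrib power_mult[symmetric])
      finally show ?thesis .
    qed
    moreover have "\<exists>\<gamma>'\<in>T. \<forall>\<tau>. \<bar>\<tau>\<bar> \<le> real N \<longrightarrow> dist (\<gamma> \<tau>) (\<gamma>' \<tau>) < \<epsilon>" if "horocyclic_within K \<gamma>" for \<gamma>
    proof (rule bexI)
      define \<gamma>' where "\<gamma>' = inv_into G cell (cell \<gamma>)"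
      have \<gamma>: "\<gamma> \<in> G" using that by (simp add: G_def)
      then show "\<gamma>' \<in> T" by (simp add: \<gamma>'_def T_def)
      have eq: "cell \<gamma>' = cell \<gamma>"
        unfolding \<gamma>'_def using \<gamma> f_inv_into_f[of "cell \<gamma>" cell G] by blast
      have \<gamma>': "\<gamma>' \<in> G"
        unfolding \<gamma>'_def using \<gamma> inv_into_into[of "cell \<gamma>" cell G] by blast
      have close: "norm (fst (hyp_coords (\<gamma> i)) - fst (hyp_coords (\<gamma>' i))) \<le> real n / real m" if "i \<in> J" for i
      proof -
        have "\<bar>(fst (hyp_coords (\<gamma> i)) - fst (hyp_coords (\<gamma>' i))) $ k\<bar> \<le> 1 / real m" for k
        proof -
          define u where "u = fst (hyp_coords (\<gamma> i)) $ k"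
          define v where "v = fst (hyp_coords (\<gamma>' i)) $ k"
          have "\<lfloor>u * real m\<rfloor> = \<lfloor>v * real m\<rfloor>"
            using fun_cong[OF eq, of "(i, k)"] that by (simp add: cell_def u_def v_def)
          then have "\<bar>u * real m - v * real m\<bar> \<le> 1" by linarith
          then have "\<bar>u - v\<bar> * real m \<le> 1" by (simp add: left_diff_distrib[symmetric] abs_mult)
          then show ?thesis using m by (simp add: u_def v_def field_simps)
        qed
        then have "(\<Sum>k\<in>UNIV. \<bar>(fst (hyp_coords (\<gamma> i)) - fst (hyp_coords (\<gamma>' i))) $ k\<bar>) \<le> (\<Sum>k\<in>(UNIV::'n set). 1 / real m)"
          by (intro sum_mono) 
        then show ?thesis
          using norm_le_l1_cart[of "fst (hyp_coords (\<gamma> i)) - fst (hyp_coords (\<gamma>' i))"] by (simp add: n_def)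
      qed
      show "\<forall>\<tau>. \<bar>\<tau>\<bar> \<le> real N \<longrightarrow> dist (\<gamma> \<tau>) (\<gamma>' \<tau>) < \<epsilon>"
      proof (intro allI impI)
        fix \<tau> :: real assume \<tau>: "\<bar>\<tau>\<bar> \<le> real N"
        show "dist (\<gamma> \<tau>) (\<gamma>' \<tau>) < \<epsilon>"
        proof (rule horocyclic_close[OF _ _ assms \<tau>])
          show "horocyclic \<gamma>" "horocyclic \<gamma>'" using \<gamma> \<gamma>' by (simp_all add: G_def horocyclic_within_def)
          fix i :: real assume "i \<in> {0, 1, -1}"
          then have "norm (fst (hyp_coords (\<gamma> i)) - fst (hyp_coords (\<gamma>' i))) \<le> real n / real m"
            using close by (simp add: J_def)
          then have "3 * (real N + 1)\<^sup>2 * norm (fst (hyp_coords (\<gamma> i)) - fst (hyp_coords (\<gamma>' i)))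
              \<le> 3 * (real N + 1)\<^sup>2 * (real n / real m)"
            by (rule mult_left_mono) simp
          also have "\<dots> = 3 * real n / real a"
            by (simp add: m_def add.commute)
          also have "\<dots> \<le> \<delta>" using a a0 \<delta> by (simp add: field_simps)
          finally show "3 * (real N + 1)\<^sup>2 * norm (fst (hyp_coords (\<gamma> i)) - fst (hyp_coords (\<gamma>' i)))
              \<le> sqrt (cosh \<epsilon> - 1)" by (simp add: \<delta>_def)
        qed
      qed
    qed
    ultimately show "\<exists>T :: (real \<Rightarrow> 'n hyp) set. finite T \<and>
        real (card T) \<le> (2 * real K * real a + 1) ^ (3 * n) * (real N + 1) ^ (6 * n) \<and>
        T \<subseteq> Collect (horocyclic_within K) \<and>
        (\<forall>\<gamma>. horocyclic_within K \<gamma> \<longrightarrow> (\<exists>\<gamma>'\<in>T. \<forall>\<tau>. \<bar>\<tau>\<bar> \<le> real N \<longrightarrow> dist (\<gamma> \<tau>) (\<gamma>' \<tau>) < \<epsilon>))"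
      unfolding G_def by blast
  qed
qed

section \<open>Union bound\<close>

lemma (in poisson_process) prob_all_counts_le:
  assumes fin: "finite I" and disj: "disjoint_family_on A I"
    and A: "\<And>i. i \<in> I \<Longrightarrow> A i \<in> sets borel" "\<And>i. i \<in> I \<Longrightarrow> bounded (A i)" "\<And>i. i \<in> I \<Longrightarrow> A i \<noteq> {}"
    and \<beta>: "\<And>i. i \<in> I \<Longrightarrow> prob {\<omega> \<in> space M. card (X \<omega> \<inter> A i) \<in> S} \<le> \<beta>"
  shows "{\<omega> \<in> space M. \<forall>i\<in>I. card (X \<omega> \<inter> A i) \<in> S} \<in> events"
    and "prob {\<omega> \<in> space M. \<forall>i\<in>I. card (X \<omega> \<inter> A i) \<in> S} \<le> \<beta> ^ card I"
proof -
  have m [measurable]: "(\<lambda>\<omega>. card (X \<omega> \<inter> A i)) \<in> M \<rightarrow>\<^sub>M count_space UNIV" if "i \<in> I" for i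
    using A that by (intro count_measurable)
  have "{\<omega> \<in> space M. card (X \<omega> \<inter> A i) \<in> S} \<in> events" if "i \<in> I" for i
    using measurable_sets[OF m[OF that], of S] by (simp add: vimage_def Int_def conj_commute)
  then show "{\<omega> \<in> space M. \<forall>i\<in>I. card (X \<omega> \<inter> A i) \<in> S} \<in> events"
    using fin by (intro sets.sets_Collect_finite_All) auto
  show "prob {\<omega> \<in> space M. \<forall>i\<in>I. card (X \<omega> \<inter> A i) \<in> S} \<le> \<beta> ^ card I"
  proof (cases "I = {}")
    case True
    then show ?thesis by simp
  next
    case False
    \<comment> \<open>The independence axiom indexes counts by the sets themselves; disjoint nonempty sets are distinct.\<close>
    have inj: "inj_on A I"
      using disj A(3) unfolding inj_on_def disjoint_family_on_def by (metis Int_absorb)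
    have "disjoint (A ` I)" using disj by (rule disjoint_family_on_disjoint_image)
    then have "indep_vars (\<lambda>_. count_space UNIV) (\<lambda>B \<omega>. card (X \<omega> \<inter> B)) (A ` I)"
      using fin A by (intro count_indep) auto
    then have "prob (\<Inter>B\<in>A ` I. (\<lambda>\<omega>. card (X \<omega> \<inter> B)) -` S \<inter> space M)
        = (\<Prod>B\<in>A ` I. prob ((\<lambda>\<omega>. card (X \<omega> \<inter> B)) -` S \<inter> space M))"
      using fin False by (intro indep_varsD_finite) auto
    also have "\<dots> = (\<Prod>i\<in>I. prob {\<omega> \<in> space M. card (X \<omega> \<inter> A i) \<in> S})"
      unfolding prod.reindex[OF inj] o_def by (intro prod.cong arg_cong[of _ _ prob]) auto
    also have "\<dots> \<le> (\<Prod>i\<in>I. \<beta>)"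
      using \<beta> by (intro prod_mono) auto
    also have "(\<Inter>B\<in>A ` I. (\<lambda>\<omega>. card (X \<omega> \<inter> B)) -` S \<inter> space M)
        = {\<omega> \<in> space M. \<forall>i\<in>I. card (X \<omega> \<inter> A i) \<in> S}"
      using False by auto
    finally show ?thesis by simp
  qed
qed

lemma poly_times_geometric_tendsto_0:
  fixes x :: real
  assumes "0 \<le> x" "x < 1"
  shows "(\<lambda>n. (real n + 1) ^ p * x ^ n) \<longlonglongrightarrow> 0"
  using assms
proof (induction p arbitrary: x)
  case 0
  then show ?case by (simp add: LIMSEQ_power_zero)
next
  case (Suc p)
  \<comment> \<open>Splitting \<open>x ^ n\<close> as \<open>y ^ n * y ^ n\<close> leaves one geometric factor for each of the two polynomial factors.\<close>
  define y where "y = sqrt x"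
  have y: "0 \<le> y" "y < 1" "x = y * y" using Suc.prems by (simp_all add: y_def)
  have "(\<lambda>n. real n * y ^ n + y ^ n) \<longlonglongrightarrow> 0 + 0"
    using y by (intro tendsto_add powser_times_n_limit_0 LIMSEQ_power_zero) auto
  then have "(\<lambda>n. ((real n + 1) ^ p * y ^ n) * (real n * y ^ n + y ^ n)) \<longlonglongrightarrow> 0 * (0 + 0)"
    by (rule tendsto_mult[OF Suc.IH[OF y(1,2)]])
  then show ?case
    by (simp add: y(3) power_mult_distrib algebra_simps)
qed

text \<open>
  Stated with measurable covers, because \<open>P\<close> will quantify over uncountably many curves.
\<close>

lemma (in prob_space) AE_not_of_small_covers:
  assumes lim: "b \<longlonglongrightarrow> 0"
    and cover: "\<And>N :: nat. \<exists>F\<in>events. {\<omega> \<in> space M. P \<omega>} \<subseteq> F \<and> prob F \<le> b N"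
  shows "AE \<omega> in M. \<not> P \<omega>"
proof -
  obtain F where F: "\<And>N. F N \<in> events" "\<And>N. {\<omega> \<in> space M. P \<omega>} \<subseteq> F N" "\<And>N. prob (F N) \<le> b N"
    using cover by metis
  define G where "G = (\<Inter>N. F N)"
  have G: "G \<in> events" unfolding G_def using F(1) by auto
  have "prob G \<le> b N" for N
    using F(3)[of N] finite_measure_mono[of G "F N"] F(1) unfolding G_def by fastforce
  then have "prob G \<le> 0"
    using lim by (intro LIMSEQ_le_const) auto
  then have "emeasure M G = 0"
    by (simp add: emeasure_eq_measure measure_le_0_iff)
  then show ?thesis
    using F(2) G by (intro AE_I[of _ _ G]) (auto simp: G_def)
qed

text \<open>
  For \<open>S = - {0}\<close> the event excluded is that every ball centred near the curve is hit by the
  process, for \<open>S = {0}\<close> that none is. Quantifying over all centres within \<open>\<epsilon>\<close> of the curve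
  makes the event pass to a nearby curve of the finite net.
\<close>

lemma AE_no_horocycle_with_all_counts:
  fixes X :: "'w \<Rightarrow> 'n::finite hyp set"
  assumes poisson: "poisson_process M \<Lambda> X"
    and pos: "0 < \<rho>" "0 < \<epsilon>" and \<beta>: "0 \<le> \<beta>" "\<beta> < 1"
    and prob_le: "\<And>z. measure M {\<omega> \<in> space M. card (X \<omega> \<inter> ball z \<rho>) \<in> S} \<le> \<beta>"
  shows "AE \<omega> in M. \<not> (\<exists>\<gamma>. horocyclic \<gamma> \<and>
    (\<forall>\<tau> z. dist (\<gamma> \<tau>) z < \<epsilon> \<longrightarrow> card (X \<omega> \<inter> ball z \<rho>) \<in> S))"
proof -
  interpret poisson_process M \<Lambda> X by (rule poisson)
  define bad where "bad \<omega> \<gamma> \<longleftrightarrow> (\<forall>\<tau> z. dist (\<gamma> \<tau>) z < \<epsilon> \<longrightarrow> card (X \<omega> \<inter> ball z \<rho>) \<in> S)"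
    for \<omega> and \<gamma> :: "real \<Rightarrow> 'n hyp"
  \<comment> \<open>Step \<open>L\<close> of the progression: points of the curve at parameters \<open>L\<close> apart have distance at least \<open>2 \<rho>\<close>.\<close>
  obtain L :: nat where L: "sqrt (2 * (cosh (2 * \<rho>) - 1)) \<le> real L"
    using real_arch_simple by blast
  have L2: "cosh (2 * \<rho>) \<le> 1 + (real L)\<^sup>2 / 2"
    using power_mono[OF L, of 2] cosh_real_ge_1[of "2 * \<rho>"] by simp
  have "AE \<omega> in M. \<not> (\<exists>\<gamma>. horocyclic_within K \<gamma> \<and> bad \<omega> \<gamma>)" for K
  proof -
    obtain c p where c: "0 \<le> c" and net:
      "\<And>N. \<exists>T :: (real \<Rightarrow> 'n::finite hyp) set. finite T \<and> real (card T) \<le> c * (real N + 1) ^ p \<and>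
        T \<subseteq> Collect (horocyclic_within K) \<and>
        (\<forall>\<gamma>. horocyclic_within K \<gamma> \<longrightarrow> (\<exists>\<gamma>'\<in>T. \<forall>\<tau>. \<bar>\<tau>\<bar> \<le> real N \<longrightarrow> dist (\<gamma> \<tau>) (\<gamma>' \<tau>) < \<epsilon>))"
      using horocyclic_net[OF pos(2), of K thesis] by blast
    show ?thesis
    proof (rule AE_not_of_small_covers)
      have "(\<lambda>N. (c * (real L + 1) ^ p) * ((real N + 1) ^ p * \<beta> ^ N)) \<longlonglongrightarrow> (c * (real L + 1) ^ p) * 0"
        using \<beta> by (intro tendsto_mult_left poly_times_geometric_tendsto_0)
      then show "(\<lambda>N. c * (real L + 1) ^ p * ((real N + 1) ^ p * \<beta> ^ N)) \<longlonglongrightarrow> 0" by simp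
      fix N :: nat
      obtain T :: "(real \<Rightarrow> 'n hyp) set" where T: "finite T" "real (card T) \<le> c * (real (N * L) + 1) ^ p"
        "T \<subseteq> Collect (horocyclic_within K)"
        "\<And>\<gamma>. horocyclic_within K \<gamma> \<Longrightarrow> \<exists>\<gamma>'\<in>T. \<forall>\<tau>. \<bar>\<tau>\<bar> \<le> real (N * L) \<longrightarrow> dist (\<gamma> \<tau>) (\<gamma>' \<tau>) < \<epsilon>"
        using net[of "N * L"] by blast
      define F where "F \<gamma> = {\<omega> \<in> space M. \<forall>j\<in>{..<N}. card (X \<omega> \<inter> ball (\<gamma> (real j * real L)) \<rho>) \<in> S}" for \<gamma>
      have F: "F \<gamma> \<in> events" "prob (F \<gamma>) \<le> \<beta> ^ N" if "\<gamma> \<in> T" for \<gamma>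
      proof -
        have \<gamma>: "horocyclic \<gamma>" using that T(3) by (auto simp: horocyclic_within_def)
        have disj: "disjoint_family_on (\<lambda>j. ball (\<gamma> (real j * real L)) \<rho>) {..<N}"
          unfolding disjoint_family_on_def
        proof (intro ballI impI)
          fix i j :: nat assume "i \<noteq> j"
          then have "1 \<le> \<bar>real i - real j\<bar>" by linarith
          then have "1\<^sup>2 \<le> \<bar>real i - real j\<bar>\<^sup>2" by (rule power_mono) simp
          then have "1 * (real L)\<^sup>2 \<le> (real i - real j)\<^sup>2 * (real L)\<^sup>2"
            by (intro mult_right_mono) auto
          also have "\<dots> = (real i * real L - real j * real L)\<^sup>2"
            by (simp add: power_mult_distrib[symmetric] left_diff_distrib)
          finally have "cosh (2 * \<rho>) \<le> cosh (dist (\<gamma> (real i * real L)) (\<gamma> (real j * real L)))"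
            using L2 \<gamma> by (simp add: horocyclic_def)
          then have "2 * \<rho> \<le> dist (\<gamma> (real i * real L)) (\<gamma> (real j * real L))"
            using pos(1) by (simp add: cosh_real_nonneg_le_iff)
          then show "ball (\<gamma> (real i * real L)) \<rho> \<inter> ball (\<gamma> (real j * real L)) \<rho> = {}"
            by (intro disjoint_ballI) simp
        qed
        show "F \<gamma> \<in> events"
          unfolding F_def using pos(1) prob_le disj by (intro prob_all_counts_le(1)[where \<beta> = \<beta>]) auto
        have "prob (F \<gamma>) \<le> \<beta> ^ card {..<N}"
          unfolding F_def using pos(1) prob_le disj by (intro prob_all_counts_le(2)) auto
        then show "prob (F \<gamma>) \<le> \<beta> ^ N" by simp
      qed
      show "\<exists>F\<in>events. {\<omega> \<in> space M. \<exists>\<gamma>. horocyclic_within K \<gamma> \<and> bad \<omega> \<gamma>} \<subseteq> F \<and>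
          prob F \<le> c * (real L + 1) ^ p * ((real N + 1) ^ p * \<beta> ^ N)"
      proof (intro bexI conjI)
        show "(\<Union>\<gamma>\<in>T. F \<gamma>) \<in> events" using T(1) F(1) by auto
        show "{\<omega> \<in> space M. \<exists>\<gamma>. horocyclic_within K \<gamma> \<and> bad \<omega> \<gamma>} \<subseteq> (\<Union>\<gamma>\<in>T. F \<gamma>)"
        proof (clarify)
          fix \<omega> \<gamma> assume \<omega>: "\<omega> \<in> space M" and \<gamma>: "horocyclic_within K \<gamma>" "bad \<omega> \<gamma>"
          obtain \<gamma>' where \<gamma>': "\<gamma>' \<in> T" "\<And>\<tau>. \<bar>\<tau>\<bar> \<le> real (N * L) \<Longrightarrow> dist (\<gamma> \<tau>) (\<gamma>' \<tau>) < \<epsilon>"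
            using T(4)[OF \<gamma>(1)] by blast
          have "card (X \<omega> \<inter> ball (\<gamma>' (real j * real L)) \<rho>) \<in> S" if "j < N" for j
          proof -
            have "\<bar>real j * real L\<bar> \<le> real (N * L)"
              using that by (simp add: mult_right_mono)
            then show ?thesis using \<gamma>'(2) \<gamma>(2) unfolding bad_def by blast
          qed
          then show "\<omega> \<in> (\<Union>\<gamma>\<in>T. F \<gamma>)" using \<gamma>'(1) \<omega> by (auto simp: F_def)
        qed
        have "prob (\<Union>\<gamma>\<in>T. F \<gamma>) \<le> (\<Sum>\<gamma>\<in>T. prob (F \<gamma>))"
          using T(1) F(1) by (intro finite_measure_subadditive_finite) auto
        also have "\<dots> \<le> (\<Sum>\<gamma>\<in>T. \<beta> ^ N)" using F(2) by (rule sum_mono)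
        also have "\<dots> = real (card T) * \<beta> ^ N" by simp
        also have "\<dots> \<le> (c * ((real L + 1) * (real N + 1)) ^ p) * \<beta> ^ N"
        proof (rule mult_right_mono)
          have "c * (real (N * L) + 1) ^ p \<le> c * ((real L + 1) * (real N + 1)) ^ p"
            using c by (intro mult_left_mono power_mono) (simp_all add: algebra_simps)
          then show "real (card T) \<le> c * ((real L + 1) * (real N + 1)) ^ p" using T(2) by linarith
        qed (use \<beta> in simp)
        also have "\<dots> = c * (real L + 1) ^ p * ((real N + 1) ^ p * \<beta> ^ N)"
          by (simp add: power_mult_distrib)
        finally show "prob (\<Union>\<gamma>\<in>T. F \<gamma>) \<le> c * (real L + 1) ^ p * ((real N + 1) ^ p * \<beta> ^ N)" .
      qed
    qed
  qed
  then have "AE \<omega> in M. \<forall>K. \<not> (\<exists>\<gamma>. horocyclic_within K \<gamma> \<and> bad \<omega> \<gamma>)"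
    by (simp add: AE_all_countable)
  then show ?thesis
    by (rule AE_mp) (intro AE_I2 impI notI, metis bad_def horocyclic_imp_within)
qed

lemma prob_ball_empty:
  fixes X :: "'w \<Rightarrow> 'n::finite hyp set"
  assumes "poisson_process M (scale_measure (ennreal lam) hyp_volume) X" "0 < lam"
  shows "measure M {\<omega> \<in> space M. card (X \<omega> \<inter> ball z \<rho>) \<in> {0}}
    = exp (- (lam * measure hyp_volume (ball z \<rho>)))"
proof -
  interpret poisson_process M "scale_measure (ennreal lam) hyp_volume" X by (rule assms(1))
  show ?thesis
    using count_poisson[of "ball z \<rho>" 0] assms(2) measure_scale_measure[of lam] by simp
qed

theorem proposition5p1:
  fixes M :: "'w measure" and X :: "'w \<Rightarrow> 'n::finite hyp set" and lam R :: real
  assumes "CARD('n) \<ge> 3" and "lam > 0" and "R > 0"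
    and "poisson_process M (scale_measure (ennreal lam) hyp_volume) X"
  shows "(AE \<omega> in M. \<not> (\<exists>P. hyp_plane P \<and> P \<subseteq> covered R (X \<omega>))) \<and>
    (AE \<omega> in M. \<not> (\<exists>P. hyp_plane P \<and> P \<subseteq> vacant R (X \<omega>)))"
proof
  interpret poisson_process M "scale_measure (ennreal lam) hyp_volume" X by (rule assms(4))
  have fin: "finite (X \<omega> \<inter> ball z r)" if "\<omega> \<in> space M" for \<omega> z r
    using that by (intro locally_finite) auto
  show "AE \<omega> in M. \<not> (\<exists>P. hyp_plane P \<and> P \<subseteq> covered R (X \<omega>))"
  proof -
    \<comment> \<open>Radius \<open>2 R\<close>: a centre within \<open>R\<close> of a covered point is within \<open>2 R\<close> of a Poisson point.\<close>
    have "0 < 2 * R" using assms(3) by simp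
    then obtain v V where "0 < v" "\<And>p :: 'n hyp. v \<le> measure hyp_volume (ball p (2 * R))"
      and V: "\<And>p :: 'n hyp. measure hyp_volume (ball p (2 * R)) \<le> V"
      by (rule hyp_volume_ball_bounds) blast
    have "0 \<le> V" using V[of undefined] measure_nonneg order_trans by blast
    have "prob {\<omega> \<in> space M. card (X \<omega> \<inter> ball z (2 * R)) \<in> - {0}} \<le> 1 - exp (- (lam * V))" for z
    proof -
      define A where "A = {\<omega> \<in> space M. card (X \<omega> \<inter> ball z (2 * R)) \<in> {0}}"
      have "(\<lambda>\<omega>. card (X \<omega> \<inter> ball z (2 * R))) \<in> M \<rightarrow>\<^sub>M count_space UNIV"
        by (intro count_measurable) auto
      from measurable_sets[OF this, of "{0}"] have "A \<in> events"
        by (simp add: A_def vimage_def Int_def conj_commute)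
      moreover have "{\<omega> \<in> space M. card (X \<omega> \<inter> ball z (2 * R)) \<in> - {0}} = space M - A"
        by (auto simp: A_def)
      ultimately have "prob {\<omega> \<in> space M. card (X \<omega> \<inter> ball z (2 * R)) \<in> - {0}} = 1 - prob A"
        by (simp add: prob_compl)
      also have "\<dots> = 1 - exp (- (lam * measure hyp_volume (ball z (2 * R))))"
        unfolding A_def prob_ball_empty[OF assms(4,2)] ..
      also have "\<dots> \<le> 1 - exp (- (lam * V))" using V[of z] assms(2) by simp
      finally show ?thesis .
    qed
    then have "AE \<omega> in M. \<not> (\<exists>\<gamma>. horocyclic \<gamma> \<and>
        (\<forall>\<tau> z. dist (\<gamma> \<tau>) z < R \<longrightarrow> card (X \<omega> \<inter> ball z (2 * R)) \<in> - {0}))"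
      using assms(2,3) \<open>0 \<le> V\<close>
      by (intro AE_no_horocycle_with_all_counts[OF assms(4), where \<beta> = "1 - exp (- (lam * V))"]) auto
    then show ?thesis
    proof (rule AE_mp, intro AE_I2 impI notI)
      fix \<omega> assume \<omega>: "\<omega> \<in> space M"
        and no: "\<not> (\<exists>\<gamma>. horocyclic \<gamma> \<and>
          (\<forall>\<tau> z. dist (\<gamma> \<tau>) z < R \<longrightarrow> card (X \<omega> \<inter> ball z (2 * R)) \<in> - {0}))"
        and "\<exists>P. hyp_plane P \<and> P \<subseteq> covered R (X \<omega>)"
      then obtain P where P: "hyp_plane P" "P \<subseteq> covered R (X \<omega>)" by blast
      obtain \<gamma> where \<gamma>: "horocyclic \<gamma>" "range \<gamma> \<subseteq> P" using hyp_plane_contains_horocycle[OF P(1)] .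
      have "card (X \<omega> \<inter> ball z (2 * R)) \<in> - {0}" if z: "dist (\<gamma> \<tau>) z < R" for \<tau> z
      proof -
        obtain x where x: "x \<in> X \<omega>" "dist x (\<gamma> \<tau>) < R"
        proof -
          have "\<gamma> \<tau> \<in> covered R (X \<omega>)" using \<gamma>(2) P(2) by blast
          then show ?thesis using that by (auto simp: covered_def)
        qed
        have "dist z x < 2 * R"
          using z x(2) dist_triangle[of z x "\<gamma> \<tau>"] by (simp add: dist_commute)
        then have "x \<in> X \<omega> \<inter> ball z (2 * R)" using x(1) by simp
        then show ?thesis using fin[OF \<omega>] by auto
      qed
      with \<gamma>(1) no show False by blast
    qed
  qed
  show "AE \<omega> in M. \<not> (\<exists>P. hyp_plane P \<and> P \<subseteq> vacant R (X \<omega>))"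
  proof -
    \<comment> \<open>Radius \<open>R / 2\<close>: a Poisson point in a ball centred within \<open>R / 2\<close> of \<open>\<gamma> \<tau>\<close> would cover \<open>\<gamma> \<tau>\<close>.\<close>
    have "0 < R / 2" using assms(3) by simp
    then obtain v V where v: "0 < v" "\<And>p :: 'n hyp. v \<le> measure hyp_volume (ball p (R / 2))"
      and "\<And>p :: 'n hyp. measure hyp_volume (ball p (R / 2)) \<le> V"
      by (rule hyp_volume_ball_bounds) blast
    have "prob {\<omega> \<in> space M. card (X \<omega> \<inter> ball z (R / 2)) \<in> {0}} \<le> exp (- (lam * v))" for z
      unfolding prob_ball_empty[OF assms(4,2)] using v(2)[of z] assms(2) by simp
    then have "AE \<omega> in M. \<not> (\<exists>\<gamma>. horocyclic \<gamma> \<and>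
        (\<forall>\<tau> z. dist (\<gamma> \<tau>) z < R / 2 \<longrightarrow> card (X \<omega> \<inter> ball z (R / 2)) \<in> {0}))"
      using assms(2,3) v(1)
      by (intro AE_no_horocycle_with_all_counts[OF assms(4), where \<beta> = "exp (- (lam * v))"]) auto
    then show ?thesis
    proof (rule AE_mp, intro AE_I2 impI notI)
      fix \<omega> assume \<omega>: "\<omega> \<in> space M"
        and no: "\<not> (\<exists>\<gamma>. horocyclic \<gamma> \<and>
          (\<forall>\<tau> z. dist (\<gamma> \<tau>) z < R / 2 \<longrightarrow> card (X \<omega> \<inter> ball z (R / 2)) \<in> {0}))"
        and "\<exists>P. hyp_plane P \<and> P \<subseteq> vacant R (X \<omega>)"
      then obtain P where P: "hyp_plane P" "P \<subseteq> vacant R (X \<omega>)" by blast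
      obtain \<gamma> where \<gamma>: "horocyclic \<gamma>" "range \<gamma> \<subseteq> P" using hyp_plane_contains_horocycle[OF P(1)] .
      have "open (covered R (X \<omega>))" by (auto simp: covered_def)
      then have vac: "vacant R (X \<omega>) = - covered R (X \<omega>)"
        by (simp add: vacant_def closure_closed closed_Compl)
      have "X \<omega> \<inter> ball z (R / 2) = {}" if z: "dist (\<gamma> \<tau>) z < R / 2" for \<tau> z
      proof (rule ccontr)
        assume "X \<omega> \<inter> ball z (R / 2) \<noteq> {}"
        then obtain x where x: "x \<in> X \<omega>" "dist z x < R / 2" by auto
        have "dist x (\<gamma> \<tau>) < R"
          using z x(2) dist_triangle[of x "\<gamma> \<tau>" z] by (simp add: dist_commute)
        then have "\<gamma> \<tau> \<in> covered R (X \<omega>)" using x(1) by (auto simp: covered_def)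
        then show False using \<gamma>(2) P(2) vac by blast
      qed
      then have "\<forall>\<tau> z. dist (\<gamma> \<tau>) z < R / 2 \<longrightarrow> card (X \<omega> \<inter> ball z (R / 2)) \<in> {0}"
        by simp
      with \<gamma>(1) no show False by blast
    qed
  qed
qed

end
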